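(* Let $K$ be a subfield of $\mathbb{R}$ such that the transcendence degree of $\mathbb{R}$ over $K$ is $\mathfrak{c}$. Then there exists a family $(A_\alpha)_{\alpha<\mathfrak{c}}$ of pairwise disjoint subsets of $\mathbb{R}$ satisfying the following conditions: (I) $\mu_*(A_\alpha)=0$ for any $\alpha<\mathfrak{c}$. (II) $\mu_*(\mathbb{R}\setminus A_\alpha)=0$ for any $\alpha<\mathfrak{c}$. (III) The (disjoint) union $\bigcup_{\alpha<\mathfrak{c}}A_\alpha$ is algebraically independent over $K$.
   Context: The set theory is ZFC. $\mathfrak{c}=2^{\aleph_0}$ is the cardinality of the continuum, regarded as an (initial) ordinal, so the index $\alpha<\mathfrak{c}$ ranges over all ordinals less than $\mathfrak{c}$. $\mathcal{B}(\mathbb{R})$ denotes the Borel $\sigma$-algebra on $\mathbb{R}$ and $\mu$ the unique measure on $\mathcal{B}(\mathbb{R})$ that maps each interval $(a,b)$ with $a<b$ in $\mathbb{R}$ to its length $b-a$. For $M\subseteq\mathbb{R}$, the inner measure of $M$ is $\mu_*(M)=\max\{\mu(B)\mid B\in\mathcal{B}(\mathbb{R}),\,B\subseteq M\}\in[0,\infty]$ (this maximum is always attained). *)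

theory Defs
  imports
    "HOL-Analysis.Analysis"
    "HOL-Algebra.Algebraic_Closure_Type"
    "HOL-Library.Poly_Mapping"
begin

unbundle cardinal_syntax

(* Subfields are those of HOL-Algebra, with ring_of_type_algebra turning the type real into a
   record-based ring; the next lemma spells out what this means in terms of the usual operations. *)
lemma subfield_ring_of_type_algebra_iff:
  fixes K :: "'a::field set"
  shows "subfield K (ring_of_type_algebra :: 'a ring) \<longleftrightarrow>
    0 \<in> K \<and> 1 \<in> K \<and> (\<forall>x\<in>K. \<forall>y\<in>K. x + y \<in> K \<and> x * y \<in> K) \<and>
    (\<forall>x\<in>K. - x \<in> K \<and> inverse x \<in> K)"
proof -
  let ?R = "ring_of_type_algebra :: 'a ring"
  interpret R: field ?R by (rule field_from_type_algebra)
  have ops: "carrier ?R = UNIV" "\<zero>\<^bsub>?R\<^esub> = 0" "\<one>\<^bsub>?R\<^esub> = 1"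
    "x \<oplus>\<^bsub>?R\<^esub> y = x + y" "x \<otimes>\<^bsub>?R\<^esub> y = x * y" for x y
    by (simp_all add: ring_of_type_algebra_def)
  have neg: "\<ominus>\<^bsub>?R\<^esub> x = - x" for x
    by (rule R.minus_equality) (simp_all add: ops)
  have inv: "inv\<^bsub>?R\<^esub> x = inverse x" if "x \<noteq> 0" for x
    by (rule R.inv_char) (use that in \<open>simp_all add: ops\<close>)
  show ?thesis
  proof
    assume K: "subfield K ?R"
    note sub = subringE[OF subfieldE(1)[OF K], unfolded ops neg]
    have "inverse x \<in> K" if "x \<in> K" for x
    proof (cases "x = 0")
      case False
      with R.subfield_m_inv(1)[OF K, of x] that show ?thesis by (simp add: ops inv)
    qed (use that in simp)
    with sub show "0 \<in> K \<and> 1 \<in> K \<and> (\<forall>x\<in>K. \<forall>y\<in>K. x + y \<in> K \<and> x * y \<in> K) \<and>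
      (\<forall>x\<in>K. - x \<in> K \<and> inverse x \<in> K)"
      by (intro conjI ballI) simp_all
  next
    assume "0 \<in> K \<and> 1 \<in> K \<and> (\<forall>x\<in>K. \<forall>y\<in>K. x + y \<in> K \<and> x * y \<in> K) \<and>
      (\<forall>x\<in>K. - x \<in> K \<and> inverse x \<in> K)"
    note K = this
    have "subring K ?R"
      by (rule R.subringI) (use K in \<open>auto simp: ops neg\<close>)
    moreover have "inv\<^bsub>?R\<^esub> x \<in> K" if "x \<in> K - {\<zero>\<^bsub>?R\<^esub>}" for x
      using that K by (simp add: ops inv)
    ultimately show "subfield K ?R" by (rule R.subfieldI')
  qed
qed

(* A multivariate polynomial is a finitely supported map from monomials to coefficients, a monomial
   being a finitely supported map from indeterminates to exponents. *)
definition mpoly_eval :: "('v \<Rightarrow> 'a) \<Rightarrow> (('v \<Rightarrow>\<^sub>0 nat) \<Rightarrow>\<^sub>0 'a) \<Rightarrow> 'a::comm_semiring_1" where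
  "mpoly_eval f p =
    (\<Sum>m\<in>Poly_Mapping.keys p. Poly_Mapping.lookup p m *
       (\<Prod>v\<in>Poly_Mapping.keys m. f v ^ Poly_Mapping.lookup m v))"

(* The indeterminates are indexed by the elements of S themselves: the substitution homomorphism
   from K[X_s : s in S], sending X_s to s, has trivial kernel. *)
definition algebraically_independent :: "'a::field set \<Rightarrow> 'a set \<Rightarrow> bool" where
  "algebraically_independent K S \<longleftrightarrow>
    (\<forall>p :: ('a \<Rightarrow>\<^sub>0 nat) \<Rightarrow>\<^sub>0 'a.
       (\<forall>m. Poly_Mapping.lookup p m \<in> K) \<and>
       (\<forall>m\<in>Poly_Mapping.keys p. Poly_Mapping.keys m \<subseteq> S) \<and>
       mpoly_eval (\<lambda>s. s) p = 0 \<longrightarrow> p = 0)"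

(* Transcendence bases of the whole field 'a over its subfield K. *)
definition transcendence_basis :: "'a::field set \<Rightarrow> 'a set \<Rightarrow> bool" where
  "transcendence_basis K B \<longleftrightarrow>
    algebraically_independent K B \<and>
    (\<forall>S. algebraically_independent K S \<and> B \<subseteq> S \<longrightarrow> S = B)"

(* All transcendence bases have the same cardinality, so asking for one of cardinality r is the
   same as asking it of all of them. *)
definition has_transcendence_degree :: "'a::field set \<Rightarrow> 'b rel \<Rightarrow> bool" where
  "has_transcendence_degree K r \<longleftrightarrow> (\<exists>B. transcendence_basis K B \<and> |B| =o r)"

(* Cardinals in HOL are well-orders of minimal length. Thus this is the initial ordinal of the
   continuum, and the elements of its field represent the ordinals below it. *)
definition continuum :: "(nat \<Rightarrow> bool) rel" where
  "continuum = ctwo ^c natLeq"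

definition inner_measure :: "real set \<Rightarrow> ennreal" where
  "inner_measure M = (SUP B\<in>{B \<in> sets borel. B \<subseteq> M}. emeasure lborel B)"

lemma inner_measure_attained:
  "\<exists>B\<in>sets borel. B \<subseteq> M \<and> emeasure lborel B = inner_measure M"
proof -
  let ?I = "{B \<in> sets borel. B \<subseteq> M}"
  have "?I \<noteq> {}" by auto
  from ennreal_SUP_countable_SUP[OF this, of "emeasure lborel"]
  obtain f :: "nat \<Rightarrow> ennreal" where f: "range f \<subseteq> emeasure lborel ` ?I"
    "(SUP B\<in>?I. emeasure lborel B) = Sup (range f)" by auto
  then have "\<forall>n. \<exists>B\<in>?I. f n = emeasure lborel B" by (auto simp: subset_iff image_iff)
  then obtain g where g: "\<And>n. g n \<in> ?I" "\<And>n. f n = emeasure lborel (g n)" by metis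
  let ?B = "\<Union>n. g n"
  have B: "?B \<in> ?I" using g(1) by auto
  have "f n \<le> emeasure lborel ?B" for n
    unfolding g(2) using B by (intro emeasure_mono) auto
  then have "inner_measure M \<le> emeasure lborel ?B"
    unfolding inner_measure_def f(2) by (intro SUP_least) auto
  moreover have "emeasure lborel ?B \<le> inner_measure M"
    unfolding inner_measure_def using B by (intro SUP_upper) auto
  ultimately show ?thesis using B by (intro bexI[of _ ?B]) auto
qed

end

theory Submission
  imports Defs
begin

text \<open>
  By the Steinhaus argument a compact set of positive measure lies in no proper subfield of the
  reals. A set of fewer than continuum many reals is algebraic over the field generated by fewer
  than continuum many elements of a transcendence basis, so its relative algebraic closure lies in
  a proper subfield. Hence, well-ordering the pairs of an ordinal below the continuum and a
  (code of a) compact set in the order type of the continuum, one can choose for each pair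
  \<open>(\<alpha>, P)\<close> a point of \<open>P\<close> that is transcendental over all earlier choices. The points
  chosen for \<open>\<alpha>\<close> form \<open>A\<^sub>\<alpha>\<close>, which meets every compact set of positive measure; since it
  misses the other \<open>A\<^sub>\<beta>\<close>, it contains none.
\<close>

section \<open>Algebraic elements over a subfield\<close>

abbreviation (input) is_subfield :: "'a::field set \<Rightarrow> bool" where
  "is_subfield K \<equiv> subfield K (ring_of_type_algebra :: 'a ring)"

lemma ring_of_type_algebra_simps:
  "carrier (ring_of_type_algebra :: 'a::field ring) = UNIV"
  "\<zero>\<^bsub>ring_of_type_algebra :: 'a ring\<^esub> = 0" "\<one>\<^bsub>ring_of_type_algebra :: 'a ring\<^esub> = 1"
  "x \<oplus>\<^bsub>ring_of_type_algebra :: 'a ring\<^esub> y = x + y"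
  "x \<otimes>\<^bsub>ring_of_type_algebra :: 'a ring\<^esub> y = x * y"
  by (simp_all add: ring_of_type_algebra_def)

lemma ring_of_type_algebra_power:
  "x [^]\<^bsub>ring_of_type_algebra :: 'a::field ring\<^esub> (n::nat) = x ^ n"
proof -
  interpret field "ring_of_type_algebra :: 'a ring" by (rule field_from_type_algebra)
  show ?thesis
    by (induction n) (simp_all add: ring_of_type_algebra_simps mult.commute)
qed

text \<open>Only the finitely many coefficients of an annihilating polynomial matter. Being
  algebraic over \<open>K\<close>, they generate a finite-dimensional extension \<open>A\<close>,
  and the tower law makes \<open>A\<close> with \<open>x\<close> adjoined finite-dimensional over
  \<open>K\<close>.\<close>

lemma (in domain) algebraic_trans:
  assumes K: "subfield K R" and L: "L \<subseteq> {x \<in> carrier R. (algebraic over K) x}"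
    and "subring L R" and x: "x \<in> carrier R" "(algebraic over L) x"
  shows "(algebraic over K) x"
proof -
  obtain p where p: "p \<in> carrier (L[X])" "p \<noteq> []" "eval p x = \<zero>"
    using algebraicE[OF assms(3) x] .
  define A where "A = finite_extension K p"
  have pL: "set p \<subseteq> L" using p(1) by (simp add: polynomial_incl univ_poly_carrier)
  have pR: "set p \<subseteq> carrier R" using pL L by auto
  have alg: "(algebraic over K) y" if "y \<in> set p" for y using that pL L by auto
  have A: "subfield A R" and fin: "finite_dimension K A"
    unfolding A_def
    using finite_extension_is_subfield[OF K pR alg] finite_extension_finite_dimension(1)[OF K pR alg]
    by auto
  have "p \<in> carrier (A[X])"
    using p(1) finite_extension_mem[OF subfieldE(1)[OF K] pR]
    unfolding A_def univ_poly_carrier[symmetric] polynomial_def by auto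
  then have "(algebraic over A) x" using p algebraicI by auto
  then have "finite_dimension A (simple_extension A x)"
    using finite_dimension_simple_extension[OF A x(1)] by simp
  then have "finite_dimension K (simple_extension A x)"
    using telescopic_base_dim(1)[OF K A fin] by simp
  moreover have "subring (simple_extension A x) R" "x \<in> simple_extension A x"
    using simple_extension_is_subring simple_extension_mem subfieldE(1)[OF A] x(1) by auto
  ultimately show ?thesis using finite_dimension_imp_algebraic[OF K] by blast
qed

text \<open>The relative algebraic closure in the ambient field, phrased with type-based polynomials
  rather than list polynomials over a ring record.\<close>

definition algebraic_elements :: "'a::field set \<Rightarrow> 'a set" where
  "algebraic_elements F =
    {x. \<exists>p. p \<noteq> 0 \<and> (\<forall>i. Polynomial.coeff p i \<in> F) \<and> poly p x = 0}"

text \<open>List polynomials start with the leading coefficient, \<open>Poly\<close> with the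
  constant one; hence the reversal.\<close>

lemma eval_ring_of_type_algebra:
  "ring.eval (ring_of_type_algebra :: 'a::field ring) p x = poly (Poly (rev p)) x"
proof -
  interpret field "ring_of_type_algebra :: 'a ring" by (rule field_from_type_algebra)
  show ?thesis
    by (induction p)
      (simp_all add: ring_of_type_algebra_simps ring_of_type_algebra_power Poly_append poly_monom
        add.commute mult.commute)
qed

text \<open>Transfers field theory about \<open>ring.algebraic\<close> to the type-based
  notion.\<close>

lemma algebraic_elements_eq:
  fixes F :: "'a::field set"
  assumes F: "is_subfield F"
  shows "algebraic_elements F =
    {x \<in> carrier ring_of_type_algebra. ring.algebraic ring_of_type_algebra F x}"
proof -
  let ?R = "ring_of_type_algebra :: 'a ring"
  interpret field ?R by (rule field_from_type_algebra)
  have F0: "0 \<in> F" using F by (simp add: subfield_ring_of_type_algebra_iff)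
  have sub: "subring F ?R" using F by (rule subfieldE)
  have "x \<in> algebraic_elements F \<longleftrightarrow> algebraic F x" for x
  proof
    assume "x \<in> algebraic_elements F"
    then obtain p where p: "p \<noteq> 0" "\<And>i. Polynomial.coeff p i \<in> F" "poly p x = 0"
      unfolding algebraic_elements_def by auto
    have "rev (coeffs p) \<in> carrier (univ_poly ?R F)" 
      using p(1,2)
      by (auto simp: univ_poly_def polynomial_def ring_of_type_algebra_simps hd_rev last_coeffs_eq_coeff_degree
          coeffs_def)
    moreover have "eval (rev (coeffs p)) x = \<zero>\<^bsub>?R\<^esub>"
      using p(3) by (simp add: eval_ring_of_type_algebra ring_of_type_algebra_simps)
    ultimately show "algebraic F x"
      using algebraicI[of "rev (coeffs p)" F x] p(1) by (simp add: over_def)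
  next
    assume "algebraic F x"
    then obtain p where p: "p \<in> carrier (univ_poly ?R F)" "p \<noteq> []" "eval p x = \<zero>\<^bsub>?R\<^esub>"
      using algebraicE[OF sub, of x] by (auto simp: ring_of_type_algebra_simps over_def)
    have pF: "set p \<subseteq> F" "hd p \<noteq> 0"
      using p by (auto simp: univ_poly_def polynomial_def ring_of_type_algebra_simps)
    \<comment> \<open>The head of \<open>p\<close> is the leading coefficient and nonzero, while a
      zero polynomial would make every entry vanish.\<close>
    have "Poly (rev p) \<noteq> 0"
    proof
      assume "Poly (rev p) = 0"
      then obtain n where "rev p = replicate n 0" by (auto simp: Poly_eq_0)
      then have "set p \<subseteq> {0}" by (metis set_replicate_conv_if set_rev empty_subsetI order_refl)
      then show False using pF(2) hd_in_set[OF p(2)] by blast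
    qed
    moreover have "Polynomial.coeff (Poly (rev p)) i \<in> F" for i
    proof (cases "i < length p")
      case True
      then have "rev p ! i \<in> set (rev p)" by (intro nth_mem) simp
      then show ?thesis using pF(1) True by (simp add: nth_default_def subset_iff)
    qed (use F0 in \<open>simp add: nth_default_def\<close>)
    moreover have "poly (Poly (rev p)) x = 0"
      using p(3) by (simp add: eval_ring_of_type_algebra ring_of_type_algebra_simps)
    ultimately show "x \<in> algebraic_elements F"
      unfolding algebraic_elements_def by blast
  qed
  then show ?thesis by (auto simp: ring_of_type_algebra_simps)
qed

lemma subfield_algebraic_elements:
  fixes F :: "'a::field set"
  assumes F: "is_subfield F"
  shows "is_subfield (algebraic_elements F)"
  using field.subfield_of_algebraics[OF field_from_type_algebra F]
  by (simp add: algebraic_elements_eq[OF F] over_def)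

lemma algebraic_elements_idem:
  fixes F :: "'a::field set"
  assumes F: "is_subfield F"
  shows "algebraic_elements (algebraic_elements F) \<subseteq> algebraic_elements F"
proof -
  interpret field "ring_of_type_algebra :: 'a ring" by (rule field_from_type_algebra)
  define L where "L = algebraic_elements F"
  have L: "is_subfield L"
    unfolding L_def by (rule subfield_algebraic_elements[OF F])
  have L_eq: "L = {x \<in> carrier ring_of_type_algebra. (algebraic over F) x}"
    unfolding L_def over_def by (rule algebraic_elements_eq[OF F])
  have "algebraic_elements L = {x \<in> carrier ring_of_type_algebra. (algebraic over L) x}"
    unfolding over_def by (rule algebraic_elements_eq[OF L])
  also have "\<dots> \<subseteq> L"
  proof
    fix x assume "x \<in> {x \<in> carrier ring_of_type_algebra. (algebraic over L) x}"
    then have x: "x \<in> carrier ring_of_type_algebra" "(algebraic over L) x"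
      unfolding mem_Collect_eq by (rule conjunct1, rule conjunct2)
    have "(algebraic over F) x"
      by (rule algebraic_trans[OF F equalityD1[OF L_eq] subfieldE(1)[OF L] x])
    then show "x \<in> L"
      unfolding L_eq mem_Collect_eq using x(1) by (intro conjI)
  qed
  finally show ?thesis unfolding L_def .
qed

lemma algebraic_elements_mono: "F \<subseteq> F' \<Longrightarrow> algebraic_elements F \<subseteq> algebraic_elements F'"
  unfolding algebraic_elements_def by blast

lemma subset_algebraic_elements:
  assumes "is_subfield F"
  shows "F \<subseteq> algebraic_elements F"
proof
  fix x assume "x \<in> F"
  then have "\<forall>i. Polynomial.coeff [:- x, 1:] i \<in> F"
    using assms unfolding subfield_ring_of_type_algebra_iff
    by (auto simp: coeff_pCons split: nat.split)
  moreover have "poly [:- x, 1:] x = 0" "[:- x, 1:] \<noteq> 0" by simp_all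
  ultimately show "x \<in> algebraic_elements F"
    unfolding algebraic_elements_def by blast
qed

section \<open>Adjoining elements to a subfield\<close>

definition monomial_eval :: "('v \<Rightarrow> 'a) \<Rightarrow> ('v \<Rightarrow>\<^sub>0 nat) \<Rightarrow> 'a::comm_semiring_1" where
  "monomial_eval f m = (\<Prod>v\<in>Poly_Mapping.keys m. f v ^ Poly_Mapping.lookup m v)"

text \<open>Two monomials have different supports, so products are taken over a common finite
  superset, whose extra indices contribute \<open>f v ^ 0 = 1\<close>.\<close>

lemma monomial_eval_superset:
  assumes "finite A" "Poly_Mapping.keys m \<subseteq> A"
  shows "monomial_eval f m = (\<Prod>v\<in>A. f v ^ Poly_Mapping.lookup m v)"
  unfolding monomial_eval_def
  by (rule prod.mono_neutral_left) (use assms in \<open>auto simp: in_keys_iff\<close>)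

lemma monomial_eval_0 [simp]: "monomial_eval f 0 = 1"
  by (simp add: monomial_eval_def)

lemma monomial_eval_single [simp]: "monomial_eval f (Poly_Mapping.single v n) = f v ^ n"
  by (subst monomial_eval_superset[of "{v}"]) auto

lemma monomial_eval_add: "monomial_eval f (m + n) = monomial_eval f m * monomial_eval f n"
proof -
  let ?A = "Poly_Mapping.keys m \<union> Poly_Mapping.keys n"
  have "Poly_Mapping.keys (m + n) \<subseteq> ?A" by (rule keys_add)
  then show ?thesis
    by (simp add: monomial_eval_superset[of ?A] lookup_add power_add prod.distrib)
qed

text \<open>The same device for sums; it also absorbs cancellation, where the keys of
  \<open>p + q\<close> are fewer than those of \<open>p\<close> and \<open>q\<close>
  together.\<close>

lemma mpoly_eval_superset:
  assumes "finite A" "Poly_Mapping.keys p \<subseteq> A"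
  shows "mpoly_eval f p = (\<Sum>m\<in>A. Poly_Mapping.lookup p m * monomial_eval f m)"
  unfolding mpoly_eval_def monomial_eval_def[symmetric]
  by (rule sum.mono_neutral_left) (use assms in \<open>auto simp: in_keys_iff\<close>)

lemma mpoly_eval_0 [simp]: "mpoly_eval f 0 = 0"
  by (simp add: mpoly_eval_def)

lemma mpoly_eval_single [simp]: "mpoly_eval f (Poly_Mapping.single m c) = c * monomial_eval f m"
  by (subst mpoly_eval_superset[of "{m}"]) auto

lemma mpoly_eval_add: "mpoly_eval f (p + q) = mpoly_eval f p + mpoly_eval f q"
proof -
  let ?A = "Poly_Mapping.keys p \<union> Poly_Mapping.keys q"
  have "Poly_Mapping.keys (p + q) \<subseteq> ?A" by (rule keys_add)
  then show ?thesis
    by (simp add: mpoly_eval_superset[of ?A] lookup_add distrib_right sum.distrib)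
qed

lemma mpoly_eval_sum: "mpoly_eval f (sum g A) = (\<Sum>i\<in>A. mpoly_eval f (g i))"
  by (induction A rule: infinite_finite_induct) (simp_all add: mpoly_eval_add)

lemma poly_mapping_eq_sum_single:
  "p = (\<Sum>m\<in>Poly_Mapping.keys p. Poly_Mapping.single m (Poly_Mapping.lookup p m))"
  by (rule poly_mapping_eqI)
    (auto simp: lookup_sum lookup_single when_def in_keys_iff)

text \<open>This expansion into terms serves both multiplicativity of substitution and closure of
  \<open>mpolys_over\<close> under products.\<close>

lemma mult_eq_sum_single:
  fixes p q :: "('v \<Rightarrow>\<^sub>0 nat) \<Rightarrow>\<^sub>0 'a::comm_semiring_1"
  shows "p * q = (\<Sum>m\<in>Poly_Mapping.keys p. \<Sum>n\<in>Poly_Mapping.keys q.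
    Poly_Mapping.single (m + n) (Poly_Mapping.lookup p m * Poly_Mapping.lookup q n))"
  by (subst poly_mapping_eq_sum_single[of p], subst poly_mapping_eq_sum_single[of q])
    (simp add: sum_product mult_single)

lemma mpoly_eval_mult:
  fixes p q :: "('v \<Rightarrow>\<^sub>0 nat) \<Rightarrow>\<^sub>0 'a::comm_semiring_1"
  shows "mpoly_eval f (p * q) = mpoly_eval f p * mpoly_eval f q"
proof -
  have "mpoly_eval f (p * q) = (\<Sum>m\<in>Poly_Mapping.keys p. \<Sum>n\<in>Poly_Mapping.keys q.
      (Poly_Mapping.lookup p m * monomial_eval f m) * (Poly_Mapping.lookup q n * monomial_eval f n))"
    by (simp add: mult_eq_sum_single mpoly_eval_sum monomial_eval_add ac_simps)
  also have "\<dots> = mpoly_eval f p * mpoly_eval f q"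
    by (simp add: mpoly_eval_superset[OF finite_keys order_refl] sum_product)
  finally show ?thesis .
qed

text \<open>The polynomial ring K[X_s : s in S], cut out of the polynomials in all indeterminates of
  the type.\<close>

definition mpolys_over :: "'a::zero set \<Rightarrow> 'v set \<Rightarrow> (('v \<Rightarrow>\<^sub>0 nat) \<Rightarrow>\<^sub>0 'a) set" where
  "mpolys_over K S = {p. (\<forall>m. Poly_Mapping.lookup p m \<in> K) \<and>
    (\<forall>m\<in>Poly_Mapping.keys p. Poly_Mapping.keys m \<subseteq> S)}"

lemma algebraically_independent_iff:
  "algebraically_independent K S \<longleftrightarrow>
    (\<forall>p\<in>mpolys_over K S. mpoly_eval (\<lambda>s. s) p = 0 \<longrightarrow> p = 0)"
  unfolding algebraically_independent_def mpolys_over_def by blast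

lemma mpolys_over_mono: "S \<subseteq> T \<Longrightarrow> mpolys_over K S \<subseteq> mpolys_over K T"
  unfolding mpolys_over_def by blast

context
  fixes K :: "'a::field set"
  assumes K: "is_subfield K"
begin

lemma subfield_closed:
  "0 \<in> K" "1 \<in> K" "x \<in> K \<Longrightarrow> y \<in> K \<Longrightarrow> x + y \<in> K" "x \<in> K \<Longrightarrow> y \<in> K \<Longrightarrow> x * y \<in> K"
  "x \<in> K \<Longrightarrow> - x \<in> K" "x \<in> K \<Longrightarrow> inverse x \<in> K"
  using K by (auto simp: subfield_ring_of_type_algebra_iff)

lemma mpolys_over_single:
  assumes "c \<in> K" "Poly_Mapping.keys m \<subseteq> S"
  shows "Poly_Mapping.single m c \<in> mpolys_over K S"
  using assms subfield_closed(1)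
  by (auto simp: mpolys_over_def lookup_single when_def split: if_splits)

lemma mpolys_over_add:
  assumes "p \<in> mpolys_over K S" "q \<in> mpolys_over K S"
  shows "p + q \<in> mpolys_over K S"
  using assms keys_add[of p q] subfield_closed(3)
  unfolding mpolys_over_def by (fastforce simp: lookup_add)

lemma mpolys_over_sum:
  assumes "\<And>i. i \<in> A \<Longrightarrow> g i \<in> mpolys_over K S"
  shows "sum g A \<in> mpolys_over K S"
  using assms
proof (induction A rule: infinite_finite_induct)
  case (insert x F)
  then show ?case by (simp add: mpolys_over_add)
qed (use subfield_closed(1) in \<open>simp_all add: mpolys_over_def\<close>)

lemma mpolys_over_mult:
  assumes "p \<in> mpolys_over K S" "q \<in> mpolys_over K S"
  shows "p * q \<in> mpolys_over K S"
  unfolding mult_eq_sum_single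
proof (intro mpolys_over_sum mpolys_over_single)
  fix m n assume "m \<in> Poly_Mapping.keys p" "n \<in> Poly_Mapping.keys q"
  then show "Poly_Mapping.keys (m + n) \<subseteq> S"
    using assms keys_add[of m n] unfolding mpolys_over_def by blast
qed (use assms in \<open>auto simp: mpolys_over_def intro: subfield_closed\<close>)

end

section \<open>Generated subrings and subfields\<close>

definition ring_adjoin :: "'a::field set \<Rightarrow> 'a set \<Rightarrow> 'a set" where
  "ring_adjoin K S = mpoly_eval (\<lambda>s. s) ` mpolys_over K S"

text \<open>K(S) as explicit fractions over K[S], so that denominators can later be cleared.\<close>

definition field_adjoin :: "'a::field set \<Rightarrow> 'a set \<Rightarrow> 'a set" where
  "field_adjoin K S = {u / v | u v. u \<in> ring_adjoin K S \<and> v \<in> ring_adjoin K S \<and> v \<noteq> 0}"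

lemma field_adjoinE:
  assumes "x \<in> field_adjoin K S"
  obtains a b where "x = a / b" "a \<in> ring_adjoin K S" "b \<in> ring_adjoin K S" "b \<noteq> 0"
  using assms unfolding field_adjoin_def mem_Collect_eq by (elim exE conjE)

lemma ring_adjoin_mono: "S \<subseteq> T \<Longrightarrow> ring_adjoin K S \<subseteq> ring_adjoin K T"
  unfolding ring_adjoin_def by (intro image_mono mpolys_over_mono)

lemma field_adjoin_mono: "S \<subseteq> T \<Longrightarrow> field_adjoin K S \<subseteq> field_adjoin K T"
  unfolding field_adjoin_def using ring_adjoin_mono by blast

context
  fixes K :: "'a::field set"
  assumes K: "is_subfield K"
begin

lemma const_in_ring_adjoin: "c \<in> K \<Longrightarrow> c \<in> ring_adjoin K S"
  unfolding ring_adjoin_def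
  by (rule image_eqI[of _ _ "Poly_Mapping.single 0 c"]) (simp_all add: mpolys_over_single[OF K])

lemma gen_in_ring_adjoin: "s \<in> S \<Longrightarrow> s \<in> ring_adjoin K S"
  unfolding ring_adjoin_def
  by (rule image_eqI[of _ _ "Poly_Mapping.single (Poly_Mapping.single s 1) 1"])
    (simp_all add: mpolys_over_single[OF K] subfield_closed[OF K])

lemma ring_adjoin_add:
  assumes "x \<in> ring_adjoin K S" "y \<in> ring_adjoin K S"
  shows "x + y \<in> ring_adjoin K S"
proof -
  obtain p q where "x = mpoly_eval (\<lambda>s. s) p" "y = mpoly_eval (\<lambda>s. s) q"
    "p \<in> mpolys_over K S" "q \<in> mpolys_over K S"
    using assms unfolding ring_adjoin_def by blast
  then show ?thesis
    unfolding ring_adjoin_def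
    by (intro image_eqI[of _ _ "p + q"]) (simp_all add: mpoly_eval_add mpolys_over_add[OF K])
qed

lemma ring_adjoin_mult:
  assumes "x \<in> ring_adjoin K S" "y \<in> ring_adjoin K S"
  shows "x * y \<in> ring_adjoin K S"
proof -
  obtain p q where "x = mpoly_eval (\<lambda>s. s) p" "y = mpoly_eval (\<lambda>s. s) q"
    "p \<in> mpolys_over K S" "q \<in> mpolys_over K S"
    using assms unfolding ring_adjoin_def by blast
  then show ?thesis
    unfolding ring_adjoin_def
    by (intro image_eqI[of _ _ "p * q"]) (simp_all add: mpoly_eval_mult mpolys_over_mult[OF K])
qed

lemma ring_adjoin_uminus:
  assumes "x \<in> ring_adjoin K S"
  shows "- x \<in> ring_adjoin K S"
  using ring_adjoin_mult[OF const_in_ring_adjoin[of "- 1"] assms] by (simp add: subfield_closed[OF K])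

lemma ring_adjoin_subset_field_adjoin: "ring_adjoin K S \<subseteq> field_adjoin K S"
proof
  fix x assume "x \<in> ring_adjoin K S"
  moreover have "1 \<in> ring_adjoin K S" by (intro const_in_ring_adjoin subfield_closed[OF K])
  ultimately show "x \<in> field_adjoin K S"
    unfolding field_adjoin_def by (intro CollectI exI[of _ x] exI[of _ 1]) simp
qed

lemma subfield_field_adjoin: "is_subfield (field_adjoin K S)"
proof -
  let ?A = "ring_adjoin K S"
  have A: "0 \<in> ?A" "1 \<in> ?A"
    by (intro const_in_ring_adjoin subfield_closed[OF K])+
  have I: "z \<in> field_adjoin K S" if "z = u / v" "u \<in> ?A" "v \<in> ?A" "v \<noteq> 0" for z u v
    using that unfolding field_adjoin_def by blast
  have "x + y \<in> field_adjoin K S \<and> x * y \<in> field_adjoin K S"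
    if xy: "x \<in> field_adjoin K S" "y \<in> field_adjoin K S" for x y
  proof -
    obtain a b where x: "x = a / b" "a \<in> ?A" "b \<in> ?A" "b \<noteq> 0"
      using field_adjoinE[OF xy(1)] .
    obtain c d where y: "y = c / d" "c \<in> ?A" "d \<in> ?A" "d \<noteq> 0"
      using field_adjoinE[OF xy(2)] .
    have "x + y = (a * d + c * b) / (b * d)" "x * y = (a * c) / (b * d)"
      using x y by (simp_all add: field_simps)
    with x y show ?thesis
      by (metis I ring_adjoin_add ring_adjoin_mult mult_eq_0_iff)
  qed
  moreover have "- x \<in> field_adjoin K S \<and> inverse x \<in> field_adjoin K S"
    if *: "x \<in> field_adjoin K S" for x
  proof -
    obtain a b where x: "x = a / b" "a \<in> ?A" "b \<in> ?A" "b \<noteq> 0"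
      using field_adjoinE[OF *] .
    have "- x = - a / b" using x by simp
    \<comment> \<open>Since \<open>inverse 0 = 0\<close>, a vanishing numerator calls for the
      fraction 0/1: turning \<open>a / b\<close> upside down would give a zero denominator.\<close>
    moreover have "inverse x = (if a = 0 then 0 else b) / (if a = 0 then 1 else a)"
      using x by simp
    ultimately show ?thesis
      using I[of "- x" "- a" b] I[of "inverse x" "if a = 0 then 0 else b" "if a = 0 then 1 else a"]
        x A ring_adjoin_uminus by (auto split: if_splits)
  qed
  moreover have "0 \<in> field_adjoin K S" "1 \<in> field_adjoin K S"
    using A ring_adjoin_subset_field_adjoin by auto
  ultimately show ?thesis unfolding subfield_ring_of_type_algebra_iff by blast
qed

end

section \<open>Relative algebraic closure and algebraic independence\<close>

text \<open>The relative algebraic closure of K(S), that is, the closure operator of the algebraic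
  matroid.\<close>

definition acl :: "'a::field set \<Rightarrow> 'a set \<Rightarrow> 'a set" where
  "acl K S = algebraic_elements (field_adjoin K S)"

lemma acl_mono: "S \<subseteq> T \<Longrightarrow> acl K S \<subseteq> acl K T"
  unfolding acl_def by (intro algebraic_elements_mono field_adjoin_mono)

lemma ring_adjoin_subset_subfield:
  assumes F: "is_subfield F" and "K \<subseteq> F" "S \<subseteq> F"
  shows "ring_adjoin K S \<subseteq> F"
proof
  fix x assume "x \<in> ring_adjoin K S"
  then obtain p where p: "p \<in> mpolys_over K S" "x = mpoly_eval (\<lambda>s. s) p"
    unfolding ring_adjoin_def by blast
  note cl = subfield_closed[OF F]
  have pow: "s ^ n \<in> F" if "s \<in> F" for s n
    using that by (induction n) (auto intro: cl)
  have prod: "(\<Prod>v\<in>A. f v) \<in> F" if "\<And>v. v \<in> A \<Longrightarrow> f v \<in> F" for A :: "'a set" and f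
    using that by (induction A rule: infinite_finite_induct) (auto intro: cl)
  have sum: "(\<Sum>v\<in>A. f v) \<in> F" if "\<And>v. v \<in> A \<Longrightarrow> f v \<in> F" for A :: "('a \<Rightarrow>\<^sub>0 nat) set" and f
    using that by (induction A rule: infinite_finite_induct) (auto intro: cl)
  show "x \<in> F"
    unfolding p(2) mpoly_eval_def
  proof (intro sum cl(4) prod pow)
    fix m v assume "m \<in> Poly_Mapping.keys p" "v \<in> Poly_Mapping.keys m"
    then show "v \<in> F" using p(1) assms(3) unfolding mpolys_over_def by blast
  qed (use p(1) assms(2) in \<open>auto simp: mpolys_over_def\<close>)
qed

lemma field_adjoin_subset_subfield:
  assumes F: "is_subfield F" and "K \<subseteq> F" "S \<subseteq> F"
  shows "field_adjoin K S \<subseteq> F"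
proof
  fix x assume "x \<in> field_adjoin K S"
  then obtain a b where "x = a / b" "a \<in> ring_adjoin K S" "b \<in> ring_adjoin K S"
    by (rule field_adjoinE)
  with ring_adjoin_subset_subfield[OF assms] show "x \<in> F"
    by (auto simp: divide_inverse intro!: subfield_closed[OF F])
qed

section \<open>Finite character of closure and independence\<close>

lemma ring_adjoin_finite:
  assumes "x \<in> ring_adjoin K S"
  shows "\<exists>T. finite T \<and> T \<subseteq> S \<and> x \<in> ring_adjoin K T"
proof -
  obtain p where p: "p \<in> mpolys_over K S" "x = mpoly_eval (\<lambda>s. s) p"
    using assms unfolding ring_adjoin_def by blast
  let ?T = "\<Union>m\<in>Poly_Mapping.keys p. Poly_Mapping.keys m"
  have "p \<in> mpolys_over K ?T" "?T \<subseteq> S" "finite ?T"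
    using p(1) unfolding mpolys_over_def by auto
  with p(2) show ?thesis unfolding ring_adjoin_def by blast
qed

lemma field_adjoin_finite:
  assumes "x \<in> field_adjoin K S"
  shows "\<exists>T. finite T \<and> T \<subseteq> S \<and> x \<in> field_adjoin K T"
proof -
  obtain a b where ab: "x = a / b" "a \<in> ring_adjoin K S" "b \<in> ring_adjoin K S" "b \<noteq> 0"
    using field_adjoinE[OF assms] .
  obtain T U where TU: "finite T" "T \<subseteq> S" "a \<in> ring_adjoin K T"
    "finite U" "U \<subseteq> S" "b \<in> ring_adjoin K U"
    using ab ring_adjoin_finite by metis
  then have "a \<in> ring_adjoin K (T \<union> U)" "b \<in> ring_adjoin K (T \<union> U)"
    using ring_adjoin_mono[of T "T \<union> U" K] ring_adjoin_mono[of U "T \<union> U" K] by auto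
  then have "x \<in> field_adjoin K (T \<union> U)"
    using ab(1,4) unfolding field_adjoin_def by blast
  with TU show ?thesis by (intro exI[of _ "T \<union> U"]) auto
qed

lemma acl_finite:
  assumes "x \<in> acl K S"
  shows "\<exists>T. finite T \<and> T \<subseteq> S \<and> x \<in> acl K T"
proof -
  obtain p where p: "p \<noteq> 0" "\<And>i. Polynomial.coeff p i \<in> field_adjoin K S" "poly p x = 0"
    using assms unfolding acl_def algebraic_elements_def by blast
  obtain T where T: "\<And>i. finite (T i) \<and> T i \<subseteq> S \<and> Polynomial.coeff p i \<in> field_adjoin K (T i)"
    using field_adjoin_finite[OF p(2)] by metis
  \<comment> \<open>The index one above the degree matters: its coefficient is 0, so including its
    support puts 0 into \<open>field_adjoin K ?U\<close>, which settles all coefficients beyond the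
    degree.\<close>
  let ?U = "(\<Union>i\<in>{..Suc (Polynomial.degree p)}. T i)"
  have "Polynomial.coeff p i \<in> field_adjoin K ?U" for i
  proof (cases "i \<le> Polynomial.degree p")
    case True
    then have "T i \<subseteq> ?U" by (intro UN_upper) simp
    then show ?thesis using T field_adjoin_mono by blast
  next
    case False
    have "T (Suc (Polynomial.degree p)) \<subseteq> ?U" by auto
    then have "Polynomial.coeff p (Suc (Polynomial.degree p)) \<in> field_adjoin K ?U"
      using T field_adjoin_mono by blast
    with False show ?thesis by (simp add: coeff_eq_0)
  qed
  then have "x \<in> acl K ?U"
    using p unfolding acl_def algebraic_elements_def by blast
  moreover have "finite ?U" "?U \<subseteq> S" using T by auto
  ultimately show ?thesis by blast
qed

text \<open>A polynomial relation mentions finitely many indeterminates, so a dependence already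
  occurs in a finite subset.\<close>

lemma algebraically_independent_finite:
  assumes "\<And>T. finite T \<Longrightarrow> T \<subseteq> S \<Longrightarrow> algebraically_independent K T"
  shows "algebraically_independent K S"
  unfolding algebraically_independent_iff
proof (intro ballI impI)
  fix p assume p: "p \<in> mpolys_over K S" "mpoly_eval (\<lambda>s. s) p = 0"
  let ?T = "\<Union>m\<in>Poly_Mapping.keys p. Poly_Mapping.keys m"
  have "p \<in> mpolys_over K ?T" "?T \<subseteq> S" "finite ?T"
    using p(1) unfolding mpolys_over_def by auto
  with assms[of ?T] p(2) show "p = 0"
    unfolding algebraically_independent_iff by blast
qed

lemma algebraically_independent_mono:
  "algebraically_independent K T \<Longrightarrow> S \<subseteq> T \<Longrightarrow> algebraically_independent K S"
  unfolding algebraically_independent_iff using mpolys_over_mono by blast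

context
  fixes K :: "'a::field set"
  assumes K: "is_subfield K"
begin

lemma subfield_acl: "is_subfield (acl K S)"
  unfolding acl_def by (intro subfield_algebraic_elements subfield_field_adjoin K)

lemma ring_adjoin_subset_acl: "ring_adjoin K S \<subseteq> acl K S"
  unfolding acl_def
  using ring_adjoin_subset_field_adjoin[OF K] subset_algebraic_elements[OF subfield_field_adjoin[OF K]]
  by blast

text \<open>The subfield \<open>acl K T\<close> contains \<open>K\<close> and \<open>S\<close>,
  hence K(S), and passing to the elements algebraic over it adds nothing.\<close>

lemma acl_subset_acl:
  assumes "S \<subseteq> acl K T"
  shows "acl K S \<subseteq> acl K T"
proof -
  have "K \<subseteq> acl K T"
    using const_in_ring_adjoin[OF K] ring_adjoin_subset_acl by blast
  then have "field_adjoin K S \<subseteq> acl K T"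
    using assms by (intro field_adjoin_subset_subfield subfield_acl)
  then have "acl K S \<subseteq> algebraic_elements (acl K T)"
    unfolding acl_def[of K S] by (rule algebraic_elements_mono)
  also have "\<dots> \<subseteq> acl K T"
    unfolding acl_def by (intro algebraic_elements_idem subfield_field_adjoin K)
  finally show ?thesis .
qed

lemma subset_acl: "S \<subseteq> acl K S"
  using gen_in_ring_adjoin[OF K] ring_adjoin_subset_acl by blast

section \<open>Independence in terms of closure\<close>

lemma field_adjoin_common_denominator:
  assumes "finite I" "\<And>i. i \<in> I \<Longrightarrow> c i \<in> field_adjoin K S"
  shows "\<exists>d\<in>ring_adjoin K S. d \<noteq> 0 \<and> (\<forall>i\<in>I. d * c i \<in> ring_adjoin K S)"
  using assms
proof (induction I rule: finite_induct)
  case empty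
  have "1 \<in> ring_adjoin K S" by (intro const_in_ring_adjoin[OF K] subfield_closed[OF K])
  then show ?case by (intro bexI[of _ 1]) auto
next
  case (insert j I)
  then obtain d where d: "d \<in> ring_adjoin K S" "d \<noteq> 0" "\<And>i. i \<in> I \<Longrightarrow> d * c i \<in> ring_adjoin K S"
    by auto
  obtain a b where ab: "c j = a / b" "a \<in> ring_adjoin K S" "b \<in> ring_adjoin K S" "b \<noteq> 0"
    using field_adjoinE[of "c j" K S] insert.prems by auto
  have "b * d * c i \<in> ring_adjoin K S" if "i \<in> insert j I" for i
  proof (cases "i = j")
    case True
    then have eq: "b * d * c i = d * a" using ab by simp
    show ?thesis unfolding eq using d(1) ab(2) by (rule ring_adjoin_mult[OF K])
  next
    case False
    then show ?thesis using that d ab ring_adjoin_mult[OF K, of b S "d * c i"] by (simp add: mult.assoc)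
  qed
  then show ?case
    using d ab ring_adjoin_mult[OF K] by (intro bexI[of _ "b * d"]) auto
qed

text \<open>Scaling by a common denominator keeps the root and moves the coefficients into K[S],
  where they are values of polynomials over \<open>K\<close>.\<close>

lemma acl_ring_adjoinE:
  assumes "x \<in> acl K S"
  obtains p where "p \<noteq> 0" "\<forall>i. Polynomial.coeff p i \<in> ring_adjoin K S" "poly p x = 0"
proof -
  obtain p where p: "p \<noteq> 0" "\<And>i. Polynomial.coeff p i \<in> field_adjoin K S" "poly p x = 0"
    using assms unfolding acl_def algebraic_elements_def by blast
  obtain d where d: "d \<in> ring_adjoin K S" "d \<noteq> 0"
    "\<And>i. i \<le> Polynomial.degree p \<Longrightarrow> d * Polynomial.coeff p i \<in> ring_adjoin K S"
    using field_adjoin_common_denominator[of "{..Polynomial.degree p}" "Polynomial.coeff p" S] p(2)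
    by (auto elim!: bexE)
  have "Polynomial.coeff (Polynomial.smult d p) i \<in> ring_adjoin K S" for i
  proof (cases "i \<le> Polynomial.degree p")
    case False
    then show ?thesis
      using const_in_ring_adjoin[OF K subfield_closed(1)[OF K]] by (simp add: coeff_eq_0)
  qed (use d in simp)
  with p d show ?thesis by (intro that[of "Polynomial.smult d p"]) auto
qed

text \<open>An equation for \<open>b\<close> over K[T] lifts to a polynomial relation among
  \<open>b\<close> and \<open>T\<close>, which is nontrivial because the lifted leading coefficient
  survives.\<close>

lemma algebraically_independent_notin_acl:
  assumes ind: "algebraically_independent K (insert b T)" and b: "b \<notin> T"
  shows "b \<notin> acl K T"
proof
  assume "b \<in> acl K T"
  then obtain p where p: "p \<noteq> 0" "\<forall>i. Polynomial.coeff p i \<in> ring_adjoin K T" "poly p b = 0"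
    by (rule acl_ring_adjoinE)
  have "\<exists>q\<in>mpolys_over K T. mpoly_eval (\<lambda>s. s) q = Polynomial.coeff p i" for i
    using p(2) unfolding ring_adjoin_def by (metis imageE)
  then obtain q where q: "\<And>i. q i \<in> mpolys_over K T"
    "\<And>i. mpoly_eval (\<lambda>s. s) (q i) = Polynomial.coeff p i" by metis
  \<comment> \<open>\<open>q i\<close> lifts the i-th coefficient; \<open>Q\<close> adds up the
    \<open>q i\<close> times the i-th power of the indeterminate of \<open>b\<close>.\<close>
  define Q where "Q = (\<Sum>i\<le>Polynomial.degree p. \<Sum>m\<in>Poly_Mapping.keys (q i).
    Poly_Mapping.single (m + Poly_Mapping.single b i) (Poly_Mapping.lookup (q i) m))"
  have "Q \<in> mpolys_over K (insert b T)"
    unfolding Q_def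
  proof (intro mpolys_over_sum[OF K] mpolys_over_single[OF K])
    fix i m assume "m \<in> Poly_Mapping.keys (q i)"
    then have "Poly_Mapping.keys m \<subseteq> T" using q(1)[of i] unfolding mpolys_over_def by blast
    then show "Poly_Mapping.keys (m + Poly_Mapping.single b i) \<subseteq> insert b T"
      using keys_add[of m "Poly_Mapping.single b i"] by (auto split: if_splits)
  qed (use q(1) in \<open>auto simp: mpolys_over_def\<close>)
  moreover have "Polynomial.coeff p i = (\<Sum>m\<in>Poly_Mapping.keys (q i).
      Poly_Mapping.lookup (q i) m * monomial_eval (\<lambda>s. s) m)" for i
    unfolding q(2)[symmetric] by (rule mpoly_eval_superset) auto
  then have "mpoly_eval (\<lambda>s. s) Q = poly p b"
    by (simp add: Q_def mpoly_eval_sum monomial_eval_add poly_altdef sum_distrib_right mult.assoc)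
  ultimately have "Q = 0"
    using ind p(3) unfolding algebraically_independent_iff by simp
  have "q (Polynomial.degree p) \<noteq> 0"
    using q(2)[of "Polynomial.degree p"] p(1) by auto
  then obtain m0 where m0: "m0 \<in> Poly_Mapping.keys (q (Polynomial.degree p))"
    by (metis all_not_in_conv keys_eq_empty)
  let ?n = "Polynomial.degree p"
  \<comment> \<open>As \<open>q i\<close> does not involve the indeterminate of \<open>b\<close>,
    its exponent in a monomial of \<open>Q\<close> recovers \<open>i\<close> and then
    \<open>m\<close>, so distinct terms never collide.\<close>
  have nb: "Poly_Mapping.lookup m b = 0" if "m \<in> Poly_Mapping.keys (q i)" for m i
  proof -
    have "b \<notin> Poly_Mapping.keys m"
      using that q(1)[of i] b unfolding mpolys_over_def by blast
    then show ?thesis by (simp add: in_keys_iff)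
  qed
  have inj: "m + Poly_Mapping.single b i = m0 + Poly_Mapping.single b ?n \<longleftrightarrow> m = m0 \<and> i = ?n"
    if "m \<in> Poly_Mapping.keys (q i)" for m i
  proof
    assume eq: "m + Poly_Mapping.single b i = m0 + Poly_Mapping.single b ?n"
    then have "Poly_Mapping.lookup (m + Poly_Mapping.single b i) b =
        Poly_Mapping.lookup (m0 + Poly_Mapping.single b ?n) b" by simp
    then have "i = ?n" using nb that m0 by (simp add: lookup_add)
    with eq show "m = m0 \<and> i = ?n" by simp
  qed simp
  have "Poly_Mapping.lookup Q (m0 + Poly_Mapping.single b ?n) =
      (\<Sum>i\<le>?n. \<Sum>m\<in>Poly_Mapping.keys (q i). if m = m0 \<and> i = ?n then Poly_Mapping.lookup (q i) m else 0)"
    unfolding Q_def lookup_sum lookup_single when_def by (intro sum.cong refl) (simp add: inj)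
  also have "\<dots> = (\<Sum>i\<le>?n. if i = ?n then Poly_Mapping.lookup (q ?n) m0 else 0)"
    by (intro sum.cong refl) (use m0 in auto)
  also have "\<dots> = Poly_Mapping.lookup (q ?n) m0" by simp
  finally show False using \<open>Q = 0\<close> m0 by (simp add: in_keys_iff)
qed

text \<open>Contrapositively, sorting a nontrivial relation by powers of \<open>x\<close> gives a
  nonzero univariate polynomial over K[S] with root \<open>x\<close>.\<close>

lemma algebraically_independent_insert:
  assumes ind: "algebraically_independent K S" and x: "x \<notin> acl K S"
  shows "algebraically_independent K (insert x S)"
  unfolding algebraically_independent_iff
proof (intro ballI impI, rule ccontr)
  fix Q assume Q: "Q \<in> mpolys_over K (insert x S)" "mpoly_eval (\<lambda>s. s) Q = 0" "Q \<noteq> 0"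
  \<comment> \<open>\<open>N\<close> bounds the exponents of \<open>x\<close>, \<open>M k\<close>
    collects the monomials with exponent \<open>k\<close>, and \<open>del\<close> erases
    \<open>x\<close> from a monomial. Thus \<open>P k\<close> is the coefficient of the k-th power
    of \<open>x\<close>, and \<open>a k\<close> its value.\<close>
  define N where "N = Max ((\<lambda>m. Poly_Mapping.lookup m x) ` Poly_Mapping.keys Q)"
  define M where "M k = {m \<in> Poly_Mapping.keys Q. Poly_Mapping.lookup m x = k}" for k
  define del where "del m = Poly_Mapping.update x 0 m" for m :: "'a \<Rightarrow>\<^sub>0 nat"
  define P where "P k = (\<Sum>m\<in>M k. Poly_Mapping.single (del m) (Poly_Mapping.lookup Q m))" for k
  define a where "a k = mpoly_eval (\<lambda>s. s) (P k)" for k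
  have le: "Poly_Mapping.lookup m x \<le> N" if "m \<in> Poly_Mapping.keys Q" for m
    unfolding N_def using that by (intro Max_ge) auto
  have M: "finite (M k)" "m \<in> M k \<Longrightarrow> m = del m + Poly_Mapping.single x k" for m k
    by (auto simp: M_def del_def lookup_update lookup_add lookup_single when_def
        intro!: poly_mapping_eqI)
  have P: "P k \<in> mpolys_over K S" for k
    unfolding P_def
  proof (intro mpolys_over_sum[OF K] mpolys_over_single[OF K])
    fix m assume "m \<in> M k"
    then show "Poly_Mapping.keys (del m) \<subseteq> S"
      using Q(1) unfolding M_def mpolys_over_def del_def by (auto simp: keys_update)
  qed (use Q(1) in \<open>auto simp: mpolys_over_def\<close>)
  have "(\<Sum>k\<le>N. a k * x ^ k) =
      (\<Sum>k\<le>N. \<Sum>m\<in>M k. Poly_Mapping.lookup Q m * monomial_eval (\<lambda>s. s) m)"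
  proof (intro sum.cong refl)
    fix k
    have "a k * x ^ k = (\<Sum>m\<in>M k. Poly_Mapping.lookup Q m *
        monomial_eval (\<lambda>s. s) (del m + Poly_Mapping.single x k))"
      by (simp add: a_def P_def mpoly_eval_sum monomial_eval_add sum_distrib_right mult.assoc)
    also have "\<dots> = (\<Sum>m\<in>M k. Poly_Mapping.lookup Q m * monomial_eval (\<lambda>s. s) m)"
      using M(2)[of _ k] by (intro sum.cong refl) simp
    finally show "a k * x ^ k = (\<Sum>m\<in>M k. Poly_Mapping.lookup Q m * monomial_eval (\<lambda>s. s) m)" .
  qed
  also have "\<dots> = mpoly_eval (\<lambda>s. s) Q"
    unfolding mpoly_eval_superset[OF finite_keys order_refl] M_def
    by (rule sum.group) (use le in auto)
  finally have sum0: "(\<Sum>k\<le>N. a k * x ^ k) = 0" using Q(2) by simp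
  obtain m0 where m0: "m0 \<in> Poly_Mapping.keys Q"
    using Q(3) by (metis all_not_in_conv keys_eq_empty)
  let ?k = "Poly_Mapping.lookup m0 x"
  \<comment> \<open>On \<open>M ?k\<close> the erased exponent is known, so \<open>del\<close> is
    injective there and no terms of \<open>P ?k\<close> cancel.\<close>
  have "Poly_Mapping.lookup (P ?k) (del m0) =
      (\<Sum>m\<in>M ?k. if m = m0 then Poly_Mapping.lookup Q m else 0)"
    unfolding P_def lookup_sum lookup_single when_def
  proof (intro sum.cong refl)
    fix m assume "m \<in> M ?k"
    then have "del m = del m0 \<longleftrightarrow> m = m0"
      using M(2)[of m ?k] M(2)[of m0 ?k] m0 by (metis (mono_tags, lifting) M_def mem_Collect_eq)
    then show "(if del m = del m0 then Poly_Mapping.lookup Q m else 0) =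
        (if m = m0 then Poly_Mapping.lookup Q m else 0)" by simp
  qed
  also have "\<dots> = Poly_Mapping.lookup Q m0"
    using M(1) m0 by (simp add: M_def)
  finally have "P ?k \<noteq> 0" using m0 by (auto simp: in_keys_iff)
  \<comment> \<open>Independence of \<open>S\<close> turns a nonzero coefficient polynomial into a
    nonzero value.\<close>
  then have "a ?k \<noteq> 0"
    using ind P unfolding a_def algebraically_independent_iff by blast
  define p where "p = (\<Sum>k\<le>N. Polynomial.monom (a k) k)"
  have coeff_p: "Polynomial.coeff p k = (if k \<le> N then a k else 0)" for k
    by (simp add: p_def coeff_sum)
  have "p \<noteq> 0"
    using coeff_p[of ?k] \<open>a ?k \<noteq> 0\<close> le[OF m0] by auto
  moreover have "Polynomial.coeff p k \<in> field_adjoin K S" for k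
    using P ring_adjoin_subset_field_adjoin[OF K] subfield_closed(1)[OF subfield_field_adjoin[OF K]]
    by (auto simp: coeff_p a_def ring_adjoin_def)
  moreover have "poly p x = 0"
    using sum0 by (simp add: p_def poly_sum poly_monom)
  ultimately have "x \<in> acl K S"
    unfolding acl_def algebraic_elements_def by blast
  with x show False ..
qed

text \<open>An element outside the closure could be inserted into \<open>B\<close>, against
  maximality.\<close>

lemma transcendence_basis_acl:
  assumes "transcendence_basis K B"
  shows "acl K B = UNIV"
proof (rule ccontr)
  assume "acl K B \<noteq> UNIV"
  then obtain x where x: "x \<notin> acl K B" by blast
  then have "algebraically_independent K (insert x B)"
    using assms algebraically_independent_insert unfolding transcendence_basis_def by blast
  then have "insert x B = B"
    using assms unfolding transcendence_basis_def by blast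
  with x subset_acl show False by blast
qed

end

section \<open>Transfinite independent chains and closures of small sets\<close>

lemma algebraically_independent_empty: "algebraically_independent K {}"
  unfolding algebraically_independent_iff
proof (intro ballI impI)
  fix p assume p: "p \<in> mpolys_over K {}" "mpoly_eval (\<lambda>s. s) p = 0"
  then have keys: "Poly_Mapping.keys p \<subseteq> {0}"
    unfolding mpolys_over_def by auto
  then have "Poly_Mapping.lookup p 0 = 0"
    using p(2) mpoly_eval_superset[of "{0}" p "\<lambda>s. s"] by simp
  with keys show "p = 0"
    by (metis in_keys_iff keys_eq_empty subset_singletonD singletonI)
qed

lemma finite_has_maximum_linear_order:
  assumes r: "Linear_order r" and "finite J" "J \<noteq> {}" "J \<subseteq> Field r"
  shows "\<exists>i\<in>J. \<forall>j\<in>J. (j, i) \<in> r"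
  using assms(2-)
proof (induction J rule: finite_ne_induct)
  case (singleton x)
  then show ?case using r by (auto simp: order_on_defs refl_on_def)
next
  case (insert x J)
  then obtain i where i: "i \<in> J" "\<forall>j\<in>J. (j, i) \<in> r" by auto
  have field: "x \<in> Field r" "i \<in> Field r" using insert.prems i(1) by auto
  then have refl: "(x, x) \<in> r" "(i, i) \<in> r"
    using r by (auto simp: order_on_defs dest: refl_onD)
  then have tot: "(x, i) \<in> r \<or> (i, x) \<in> r"
    using field r by (cases "x = i") (auto simp: order_on_defs total_on_def)
  have "trans r" using r by (auto simp: order_on_defs)
  from tot show ?case
  proof
    assume "(x, i) \<in> r"
    with i show ?thesis by blast
  next
    assume ix: "(i, x) \<in> r"
    have "(j, x) \<in> r" if "j \<in> J" for j
      using transD[OF \<open>trans r\<close> _ ix] i(2) that by blast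
    with refl(1) show ?thesis by blast
  qed
qed

text \<open>By finite character a finite index set \<open>J\<close> suffices. The value at its
  largest index avoids the closure of the other values, so these can be inserted one at a
  time.\<close>

lemma algebraically_independent_chain:
  fixes K :: "'a::field set" and f :: "'i \<Rightarrow> 'a"
  assumes K: "is_subfield K" and r: "Linear_order r"
    and f: "\<And>i. i \<in> Field r \<Longrightarrow> f i \<notin> acl K (f ` underS r i)"
  shows "algebraically_independent K (f ` Field r)"
proof (rule algebraically_independent_finite)
  fix T assume "finite T" "T \<subseteq> f ` Field r"
  then obtain J where J: "finite J" "J \<subseteq> Field r" "T = f ` J"
    by (meson finite_subset_image)
  from J(1,2) have "algebraically_independent K (f ` J)"
  proof (induction J rule: finite_psubset_induct)
    case (psubset J)
    show ?case
    proof (cases "J = {}")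
      case False
      then obtain i where i: "i \<in> J" "\<forall>j\<in>J. (j, i) \<in> r"
        using finite_has_maximum_linear_order[OF r psubset.hyps(1)] psubset.prems by auto
      have "algebraically_independent K (f ` (J - {i}))"
        using psubset.IH[of "J - {i}"] psubset.prems i(1) by blast
      moreover have "f ` (J - {i}) \<subseteq> f ` underS r i"
        using i(2) by (auto simp: underS_def)
      then have "f i \<notin> acl K (f ` (J - {i}))"
        using f[of i] i(1) psubset.prems acl_mono[of "f ` (J - {i})" "f ` underS r i" K] by blast
      ultimately have "algebraically_independent K (insert (f i) (f ` (J - {i})))"
        by (rule algebraically_independent_insert[OF K])
      then show ?thesis using i(1) by (metis image_insert insert_Diff)
    qed (simp add: algebraically_independent_empty)
  qed
  then show "algebraically_independent K T" using J(3) by simp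
qed

lemma card_of_finite_ordLess_infinite: "finite A \<Longrightarrow> infinite B \<Longrightarrow> |A| <o |B|"
  using finite_ordLess_infinite[OF card_of_Well_order card_of_Well_order, of A B]
  by (simp add: Field_card_of)

text \<open>Each element of \<open>S\<close> is algebraic over \<open>K\<close> with finitely many
  basis elements adjoined. These supports form a \<open>T\<close> smaller than \<open>B\<close>, and
  by independence a basis element outside \<open>T\<close> is not in \<open>acl K T\<close>.\<close>

lemma acl_small_proper:
  fixes K :: "'a::field set"
  assumes K: "is_subfield K" and B: "transcendence_basis K B" "infinite B"
    and S: "|S| <o |B|"
  obtains T where "acl K S \<subseteq> acl K T" "acl K T \<noteq> UNIV"
proof -
  have "\<exists>T. finite T \<and> T \<subseteq> B \<and> x \<in> acl K T" for x
    using acl_finite[of x K B] transcendence_basis_acl[OF K B(1)] by auto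
  then obtain supp where supp: "\<And>x. finite (supp x)" "\<And>x. supp x \<subseteq> B" "\<And>x. x \<in> acl K (supp x)"
    by metis
  define T where "T = (\<Union>x\<in>S. supp x)"
  have "|T| <o |B|"
  \<comment> \<open>For finite \<open>S\<close> the union is finite and \<open>B\<close> is not; for
    infinite \<open>S\<close> a union of \<open>|S|\<close> many finite sets has at most
    \<open>|S|\<close> elements.\<close>
  proof (cases "finite S")
    case True
    then have "finite T" using supp(1) by (auto simp: T_def)
    then show ?thesis using B(2) by (intro card_of_finite_ordLess_infinite)
  next
    case False
    have "|T| \<le>o |S|" unfolding T_def
    proof (rule card_of_UNION_ordLeq_infinite[OF False card_of_refl[THEN ordIso_imp_ordLeq]], rule ballI)
      fix x
      show "|supp x| \<le>o |S|"
        using card_of_finite_ordLess_infinite[OF supp(1) False] by (rule ordLess_imp_ordLeq)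
    qed
    with S show ?thesis by (rule ordLeq_ordLess_trans[rotated])
  qed
  moreover have "T \<subseteq> B" using supp(2) by (auto simp: T_def)
  ultimately obtain b where b: "b \<in> B" "b \<notin> T"
    using not_ordLess_ordIso[of "|T|" "|B|"] card_of_refl[of B] by (metis subsetI subset_antisym)
  have "algebraically_independent K (insert b T)"
    using B(1) b(1) \<open>T \<subseteq> B\<close> algebraically_independent_mono[of K B "insert b T"]
    unfolding transcendence_basis_def by auto
  then have "b \<notin> acl K T"
    using b(2) by (rule algebraically_independent_notin_acl[OF K])
  moreover have "S \<subseteq> acl K T"
  proof
    fix x assume "x \<in> S"
    then have "supp x \<subseteq> T" by (auto simp: T_def)
    then show "x \<in> acl K T" using supp(3) acl_mono by blast
  qed
  then have "acl K S \<subseteq> acl K T" by (rule acl_subset_acl[OF K])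
  ultimately show ?thesis using that by blast
qed

section \<open>Compact sets of positive measure\<close>

text \<open>The Steinhaus argument: small translates of \<open>P\<close> meet \<open>P\<close>, so
  differences of its points fill a neighbourhood of 0, whose integer multiples cover the
  line.\<close>

lemma subset_additive_subgroup_imp_UNIV:
  fixes P G :: "real set"
  assumes P: "compact P" "emeasure lborel P > 0" "P \<subseteq> G"
    and G: "\<And>x y. x \<in> G \<Longrightarrow> y \<in> G \<Longrightarrow> x - y \<in> G"
  shows "G = UNIV"
proof -
  have fin: "emeasure lborel P < \<infinity>" using P(1) by (rule emeasure_compact_finite)
  then have "0 < enn2real (emeasure lborel P)"
    using P(2) by (simp add: enn2real_positive_iff)
  \<comment> \<open>With the measure of \<open>P\<close> as tolerance, \<open>U - P\<close> has no
    room for a translate of \<open>P\<close>.\<close>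
  then obtain U where U: "open U" "P \<subseteq> U" "emeasure lborel (U - P) < emeasure lborel P"
    using outer_regular_lborel[of P "enn2real (emeasure lborel P)"] P(1) fin
    by (auto simp: borel_compact)
  \<comment> \<open>By compactness one radius works at all points of \<open>P\<close>, so translates
    by less than \<open>e\<close> stay inside \<open>U\<close>.\<close>
  obtain e where e: "e > 0" "(\<Union>x\<in>P. ball x e) \<subseteq> U"
    using compact_subset_open_imp_ball_epsilon_subset[OF P(1) U(1,2)] .
  have small: "t \<in> G" if "\<bar>t\<bar> < e" for t
  proof -
    have "P \<inter> (+) t ` P \<noteq> {}"
    proof
      assume "P \<inter> (+) t ` P = {}"
      moreover have "(+) t ` P \<subseteq> U"
        using e(2) that by (force simp: dist_real_def)
      ultimately have "emeasure lborel ((+) t ` P) \<le> emeasure lborel (U - P)"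
        using U(1) P(1) by (intro emeasure_mono) (auto simp: borel_compact)
      moreover have "(+) t ` P \<in> sets borel"
        using compact_translation[OF P(1), of t] by (simp add: borel_compact)
      then have "emeasure (distr lborel borel ((+) t)) ((+) t ` P) = emeasure lborel P"
        by (subst emeasure_distr) (auto simp: inj_vimage_image_eq)
      then have "emeasure lborel ((+) t ` P) = emeasure lborel P"
        by (simp add: lborel_distr_plus)
      ultimately show False using U(3) by simp
    qed
    then obtain x y where "x \<in> P" "y \<in> P" "x = t + y" by auto
    then show ?thesis using P(3) G[of x y] by auto
  qed
  have zero: "0 \<in> G" using small[of 0] e(1) by simp
  have add: "x + y \<in> G" if "x \<in> G" "y \<in> G" for x y
    using G[OF that(1) G[OF zero that(2)]] by simp
  have mult: "real n * x \<in> G" if "x \<in> G" for n x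
    using that by (induction n) (auto simp: zero add distrib_right)
  have "z \<in> G" for z
  proof -
    \<comment> \<open>Dividing \<open>z\<close> by a large \<open>n\<close> brings it into the
      neighbourhood of 0 already known to lie in \<open>G\<close>.\<close>
    obtain n where n: "\<bar>z\<bar> / e < real n" using reals_Archimedean2 by blast
    then have "n > 0" using e(1) by (cases n) (auto simp: divide_less_0_iff not_less)
    with n e(1) have "\<bar>z / real n\<bar> < e" by (simp add: field_simps)
    then show ?thesis using mult[OF small, of "z / real n" n] \<open>n > 0\<close> by simp
  qed
  then show ?thesis by blast
qed

text \<open>Inner approximation by closed sets leaves positive measure, and exhausting the closed
  set by balls makes it bounded.\<close>

lemma borel_positive_imp_compact_positive:
  fixes B :: "'a::euclidean_space set"
  assumes B: "B \<in> sets borel" "emeasure lborel B > 0"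
  obtains P where "compact P" "P \<subseteq> B" "emeasure lborel P > 0"
proof -
  \<comment> \<open>The tolerance must be a positive real not exceeding the measure of
    \<open>B\<close>, which may be infinite; then \<open>B - T\<close> cannot carry all of that
    measure.\<close>
  have "\<exists>e::real. e > 0 \<and> ennreal e \<le> emeasure lborel B"
  proof (cases "emeasure lborel B" rule: ennreal_cases)
    case (real r)
    with B(2) show ?thesis by (intro exI[of _ r]) simp
  next
    case top
    then show ?thesis by (intro exI[of _ 1]) simp
  qed
  then obtain e :: real where e: "e > 0" "ennreal e \<le> emeasure lborel B" by blast
  obtain T where T: "closed T" "T \<subseteq> B" "emeasure lebesgue (B - T) < ennreal e"
    using sets_lebesgue_inner_closed[OF _ e(1), of B] B(1) by (metis sets_completionI_sets sets_lborel)
  have T0: "emeasure lborel T \<noteq> 0"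
  proof
    assume "emeasure lborel T = 0"
    moreover have "T \<union> (B - T) = B" using T(2) by blast
    ultimately have "emeasure lborel B \<le> emeasure lborel (B - T)"
      using emeasure_subadditive[of T lborel "B - T"] T(1) B(1) by simp
    with T(1,3) B(1) e(2) show False by (simp add: sets.Diff)
  qed
  have "\<exists>n. emeasure lborel (T \<inter> cball 0 (real n)) \<noteq> 0"
  proof (rule ccontr)
    assume "\<not> ?thesis"
    then have "emeasure lborel (\<Union>n. T \<inter> cball 0 (real n)) = 0"
      using T(1) by (intro emeasure_UN_eq_0) auto
    moreover have "x \<in> (\<Union>n. cball 0 (real n))" for x :: 'a
    proof -
      obtain n where "norm x \<le> real n" using real_arch_simple by blast
      then show ?thesis by (intro UN_I[of n]) simp_all
    qed
    then have "(\<Union>n. T \<inter> cball 0 (real n)) = T" by blast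
    ultimately show False using T0 by simp
  qed
  then obtain n where "emeasure lborel (T \<inter> cball 0 (real n)) \<noteq> 0" by blast
  moreover have "compact (T \<inter> cball 0 (real n))"
    using T(1) by (intro closed_Int_compact compact_cball)
  ultimately show ?thesis using that T(2) by (meson Int_lower1 order_trans not_gr_zero)
qed

text \<open>The complement of a closed set is a union of members of a countable base, and a boolean
  sequence records which ones.\<close>

lemma ex_closed_set_code:
  "\<exists>code :: (nat \<Rightarrow> bool) \<Rightarrow> 'a::second_countable_topology set. \<forall>S. closed S \<longrightarrow> S \<in> range code"
proof -
  obtain B :: "'a set set" where B: "countable B" "topological_basis B"
    using ex_countable_basis by blast
  have "S \<in> range (\<lambda>u. - \<Union>{from_nat_into B n |n. u n})" if S: "closed S" for S
  proof -
    obtain B' where B': "B' \<subseteq> B" "\<Union>B' = - S"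
      using B(2) open_Compl[OF S] unfolding topological_basis_def by blast
    have "{from_nat_into B n |n. from_nat_into B n \<in> B'} = B'"
      using B' from_nat_into_surj[OF B(1)] by blast
    then show ?thesis using B'(2)
      by (intro range_eqI[of _ _ "\<lambda>n. from_nat_into B n \<in> B'"]) simp
  qed
  then show ?thesis by blast
qed

section \<open>The transfinite construction\<close>

lemma continuum_eq: "continuum = |UNIV :: (nat \<Rightarrow> bool) set|"
proof -
  have "Func (UNIV :: nat set) (UNIV :: bool set) = UNIV"
    unfolding Func_def by auto
  then show ?thesis
    by (simp add: continuum_def cexp_def ctwo_def Field_card_of Field_natLeq)
qed

text \<open>The indices are well-ordered in their least order type. At each stage fewer than
  \<open>|B|\<close> values have been chosen, so their closure lies in a proper subfield and
  \<open>Q i\<close> has a point outside it.\<close>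

lemma algebraically_independent_chain_exists:
  fixes K :: "'a::field set" and Q :: "'i \<Rightarrow> 'a set"
  assumes K: "is_subfield K" and B: "transcendence_basis K B" "infinite B"
    and card: "|UNIV :: 'i set| \<le>o |B|"
    and Q: "\<And>i F. is_subfield F \<Longrightarrow> F \<noteq> UNIV \<Longrightarrow> \<not> Q i \<subseteq> F"
  obtains f where "\<forall>i. f i \<in> Q i" "inj f" "algebraically_independent K (range f)"
proof -
  let ?r = "|UNIV :: 'i set|"
  have r: "Card_order ?r" "Well_order ?r" "Field ?r = UNIV"
    using card_of_Card_order card_of_Well_order by (simp_all add: Field_card_of)
  then have lin: "Linear_order ?r" and wf: "wf (?r - Id)"
    by (simp_all add: well_order_on_def)
  \<comment> \<open>Admissibility at \<open>i\<close> depends on \<open>f\<close> only below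
    \<open>i\<close>, as well-founded choice requires.\<close>
  let ?P = "\<lambda>f i y. y \<in> Q i \<and> y \<notin> acl K (f ` underS ?r i)"
  have "\<exists>f. \<forall>i. ?P f i (f i)"
  proof (rule dependent_wf_choice[OF wf])
    fix f g :: "'i \<Rightarrow> 'a" and i y
    assume "\<And>j. (j, i) \<in> ?r - Id \<Longrightarrow> f j = g j"
    then have "f ` underS ?r i = g ` underS ?r i"
      by (intro image_cong) (auto simp: underS_def)
    then show "?P f i y = ?P g i y" by simp
  next
    fix i and f :: "'i \<Rightarrow> 'a"
    have "|f ` underS ?r i| \<le>o |underS ?r i|" by (rule card_of_image)
    \<comment> \<open>Proper initial segments of a cardinal order are strictly smaller.\<close>
    moreover have "|underS ?r i| <o ?r"
      using r by (intro card_of_underS) auto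
    ultimately have "|f ` underS ?r i| <o |B|"
      using card by (blast intro: ordLeq_ordLess_trans ordLess_ordLeq_trans)
    then obtain T where T: "acl K (f ` underS ?r i) \<subseteq> acl K T" "acl K T \<noteq> UNIV"
      by (rule acl_small_proper[OF K B])
    then show "\<exists>y. ?P f i y"
      using Q[OF subfield_acl[OF K], of T i] by blast
  qed
  then obtain f where f: "\<And>i. f i \<in> Q i" "\<And>i. f i \<notin> acl K (f ` underS ?r i)" by blast
  \<comment> \<open>Of two indices, the later one has a value outside a closure that contains the
    earlier value.\<close>
  have "f i \<noteq> f j" if "i \<noteq> j" for i j
  proof -
    have *: "f i \<noteq> f j" if "j \<in> underS ?r i" for i j
      using f(2)[of i] subset_acl[OF K, of "f ` underS ?r i"] that by (metis imageI subsetD)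
    have "i \<in> underS ?r j \<or> j \<in> underS ?r i"
      using lin that r(3) by (auto simp: underS_def order_on_defs total_on_def)
    with *[of i j] *[of j i] show ?thesis by auto
  qed
  then have "inj f" by (auto simp: inj_def)
  moreover have "algebraically_independent K (range f)"
    using algebraically_independent_chain[OF K lin, of f] f(2) r(3) by simp
  ultimately show ?thesis using that f(1) by blast
qed

text \<open>Any Borel subset of positive measure would contain a compact one, so compact sets
  suffice as tests.\<close>

lemma inner_measure_eq_0:
  assumes "\<And>P. compact P \<Longrightarrow> emeasure lborel P > 0 \<Longrightarrow> \<not> P \<subseteq> M"
  shows "inner_measure M = 0"
proof -
  have "emeasure lborel B = 0" if B: "B \<in> sets borel" "B \<subseteq> M" for B
  proof (rule ccontr)
    assume "emeasure lborel B \<noteq> 0"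
    then obtain P where "compact P" "P \<subseteq> B" "emeasure lborel P > 0"
      using borel_positive_imp_compact_positive[OF B(1)] by (auto simp: zero_less_iff_neq_zero)
    with assms[of P] B(2) show False by blast
  qed
  then show ?thesis
    unfolding inner_measure_def by (intro SUP_eq_const) auto
qed

theorem proposition2p3:
  fixes K :: "real set"
  assumes "subfield K (ring_of_type_algebra :: real ring)"
    and "has_transcendence_degree K continuum"
  shows "\<exists>A :: (nat \<Rightarrow> bool) \<Rightarrow> real set.
    disjoint_family_on A (Field continuum) \<and>
    (\<forall>\<alpha>\<in>Field continuum. inner_measure (A \<alpha>) = 0) \<and>
    (\<forall>\<alpha>\<in>Field continuum. inner_measure (UNIV - A \<alpha>) = 0) \<and>
    algebraically_independent K (\<Union>\<alpha>\<in>Field continuum. A \<alpha>)"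
proof -
  obtain B where B: "transcendence_basis K B" "|B| =o |UNIV :: (nat \<Rightarrow> bool) set|"
    using assms(2) unfolding has_transcendence_degree_def continuum_eq by blast
  have inf: "infinite (UNIV :: (nat \<Rightarrow> bool) set)"
    by (simp add: finite_UNIV_fun)
  then have infB: "infinite B"
    using card_of_ordIso_finite[OF B(2)] by simp
  \<comment> \<open>The construction is indexed by pairs of a family index and a set code; squaring
    keeps the infinite cardinal.\<close>
  have card: "|UNIV :: ((nat \<Rightarrow> bool) \<times> (nat \<Rightarrow> bool)) set| \<le>o |B|"
    using card_of_Times_same_infinite[OF inf] B(2)
    by (metis UNIV_Times_UNIV ordIso_iff_ordLeq ordIso_symmetric ordIso_transitive)
  obtain code :: "(nat \<Rightarrow> bool) \<Rightarrow> real set" where code: "\<And>S. closed S \<Longrightarrow> S \<in> range code"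
    using ex_closed_set_code by blast
  \<comment> \<open>Codes of other sets get the default target \<open>UNIV\<close>, so that no
    target lies in a proper subfield.\<close>
  define Q where "Q i = (if compact (code (snd i)) \<and> emeasure lborel (code (snd i)) > 0
    then code (snd i) else UNIV)" for i :: "(nat \<Rightarrow> bool) \<times> (nat \<Rightarrow> bool)"
  have Q: "\<not> Q i \<subseteq> F" if F: "is_subfield F" "F \<noteq> UNIV" for i F
  proof -
    have "x - y \<in> F" if "x \<in> F" "y \<in> F" for x y
      using subfield_closed(3)[OF F(1) that(1) subfield_closed(5)[OF F(1) that(2)]] by simp
    then show ?thesis
      using subset_additive_subgroup_imp_UNIV[of "Q i" F] F(2)
      unfolding Q_def by (auto split: if_splits)
  qed
  obtain f where f: "\<forall>i. f i \<in> Q i" "inj f" "algebraically_independent K (range f)"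
    using algebraically_independent_chain_exists[OF assms(1) B(1) infB card Q] .
  \<comment> \<open>The first component selects the member of the family; the second runs through
    all codes, so each member gets a point of every compact set of positive measure.\<close>
  define A where "A \<alpha> = range (\<lambda>u. f (\<alpha>, u))" for \<alpha>
  have meets: "A \<alpha> \<inter> P \<noteq> {}" if P: "compact P" "emeasure lborel P > 0" for \<alpha> P
  proof -
    obtain u where "P = code u" using code[OF compact_imp_closed[OF P(1)]] by blast
    with P f(1)[rule_format, of "(\<alpha>, u)"] show ?thesis unfolding A_def Q_def by auto
  qed
  have disj: "A \<alpha> \<inter> A \<beta> = {}" if "\<alpha> \<noteq> \<beta>" for \<alpha> \<beta>
    using that f(2) unfolding A_def by (auto dest: injD)
  have "inner_measure (A \<alpha>) = 0" for \<alpha>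
  proof (rule inner_measure_eq_0)
    fix P :: "real set" assume "compact P" "emeasure lborel P > 0"
    \<comment> \<open>A \<open>P\<close> inside \<open>A \<alpha>\<close> would be disjoint from
      \<open>A \<beta>\<close>, which has to meet it.\<close>
    moreover obtain \<beta> :: "nat \<Rightarrow> bool" where "\<beta> \<noteq> \<alpha>"
      by (metis (full_types) fun_upd_same)
    ultimately show "\<not> P \<subseteq> A \<alpha>"
      using meets[of P \<beta>] disj[of \<alpha> \<beta>] by blast
  qed
  moreover have "inner_measure (UNIV - A \<alpha>) = 0" for \<alpha>
    using meets by (intro inner_measure_eq_0) blast
  moreover have "algebraically_independent K (\<Union>\<alpha>\<in>Field continuum. A \<alpha>)"
    using f(3) by (rule algebraically_independent_mono) (auto simp: A_def)
  moreover have "disjoint_family_on A (Field continuum)"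
    using disj by (auto simp: disjoint_family_on_def)
  ultimately show ?thesis by blast
qed

end
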